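(* Let $\lambda>0$, $\kappa\in(0,1)$, and let $X$ be a $\mathrm{PDS}(\gamma,\lambda,\kappa)$ random variable with $\gamma=1$. Then for every integer $n\ge1$ the $n$-th factorial moment of $X$ is $$\mathrm{E}\left[(X)_n\right]=\frac{\kappa^n}{(1-\kappa)^n}\,n!\sum_{s=0}^{n-1}\frac{1}{(s+1)!}\binom{n-1}{s}\frac{\lambda^{s+1}}{\kappa^{s+1}}.$$
   Context: For $\gamma\in(0,1]$, $\lambda>0$, $\kappa\in[0,1)$, $\mathrm{PDS}(\gamma,\lambda,\kappa)$ denotes the distribution on $\mathbb{N}_0$ with probability generating function $\mathcal{P}(z)=\mathrm{E}z^X=\exp\left\{-\lambda\left(\frac{1-z}{1-\kappa z}\right)^{\gamma}\right\}$. The falling factorial is $(x)_n=x(x-1)\cdots(x-n+1)$. *)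

theory Defs
  imports "HOL-Probability.Probability"
begin

definition falling_factorial :: "real \<Rightarrow> nat \<Rightarrow> real" where
  "falling_factorial x n = (\<Prod>i<n. x - real i)"

text \<open>Probability generating function \<open>E z\<^sup>X\<close> of a law on the natural numbers; only used for
  \<open>\<bar>z\<bar> \<le> 1\<close>, where the integrand is bounded and hence integrable.\<close>
definition pgf :: "nat measure \<Rightarrow> real \<Rightarrow> real" where
  "pgf D z = (\<integral>k. z ^ k \<partial>D)"

text \<open>\<open>D\<close> is the law \<open>PDS(\<gamma>, l, \<kappa>)\<close>, where \<open>l\<close> is the parameter usually written as a
  lambda. For \<open>\<bar>z\<bar> \<le> 1\<close> and \<open>0 \<le> \<kappa> < 1\<close> the base of \<open>powr\<close> is nonnegative, and \<open>0 powr \<gamma> = 0\<close> is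
  the intended value at \<open>z = 1\<close> since \<open>\<gamma> > 0\<close>.\<close>
definition is_PDS :: "real \<Rightarrow> real \<Rightarrow> real \<Rightarrow> nat measure \<Rightarrow> bool" where
  "is_PDS \<gamma> l \<kappa> D \<longleftrightarrow>
     0 < \<gamma> \<and> \<gamma> \<le> 1 \<and> 0 < l \<and> 0 \<le> \<kappa> \<and> \<kappa> < 1 \<and>
     prob_space D \<and> sets D = UNIV \<and>
     (\<forall>z. \<bar>z\<bar> \<le> 1 \<longrightarrow> pgf D z = exp (- l * ((1 - z) / (1 - \<kappa> * z)) powr \<gamma>))"

end

theory Submission
  imports Defs
begin

text \<open>
  For \<open>\<gamma> = 1\<close> the generating function factors: with \<open>\<mu> = l (1 - \<kappa>) / \<kappa>\<close>,
  \[ - l \frac{1 - z}{1 - \kappa z} = - l + \mu \frac{\kappa z}{1 - \kappa z}. \]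
  Put \<open>y = \<kappa> z\<close>; since \<open>y / (1 - y) = 1 / (1 - y) - 1\<close>, the generating function is a constant
  times \<open>exp (\<mu> / (1 - y))\<close>.  Expanding this exponential in powers of \<open>1 / (1 - y)\<close>, and each
  \<open>(1 - y)\<^bsup>-j\<^esup>\<close> by the negative binomial series, exhibits the law as a Poisson mixture of negative
  binomial laws.  Both kinds of law have explicit moments:

  \<^item> for the negative binomial law with weights proportional to the terms of that series, the
    \<open>n\<close>-th factorial moment is the rising factorial of \<open>j\<close> times \<open>(y / (1 - y))\<^sup>n\<close>
    (lemma \<open>negative_binomial_factorial_sum\<close>);
  \<^item> for the Poisson law, the mean of a rising factorial is a Lah polynomial, by Vandermonde's
    identity (lemma \<open>poisson_rising_factorial\<close>).

  All terms are nonnegative for \<open>y \<ge> 0\<close>, so the double series converges absolutely for \<open>\<bar>y\<bar> < 1\<close>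
  and the two summations may be exchanged.  The outcome is
  lemma \<open>lah_factorial_generating_function\<close>, an identity for the sums of \<open>(k)\<^sub>n y\<^sup>k\<close> against the
  weights \<open>lah_poly k \<mu> / k!\<close>.  It is used twice, each time multiplied by \<open>exp (- l)\<close>.  With \<open>n = 0\<close>
  and \<open>y = \<kappa> z\<close> it is the power series of the generating function, and hence, by uniqueness of
  power series coefficients, it identifies the point masses of the law.  With general \<open>n\<close> and
  \<open>y = \<kappa>\<close>, that is at \<open>z = 1\<close>, it is the factorial moment; there \<open>\<mu> / (1 - \<kappa>) = l / \<kappa>\<close>, which
  explains the argument \<open>l / \<kappa>\<close> of the final polynomial.
\<close>

section \<open>Falling and rising factorials\<close>

lemma falling_factorial_eq_0:
  assumes "k < n"
  shows "falling_factorial (real k) n = 0"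
  using assms unfolding falling_factorial_def by (intro prod_zero) auto

lemma falling_factorial_add:
  "falling_factorial (real (m + n)) n = fact (m + n) / fact m"
proof (induction n)
  case 0
  then show ?case by (simp add: falling_factorial_def)
next
  case (Suc n)
  have "falling_factorial (real (m + Suc n)) (Suc n)
      = real (m + Suc n) * falling_factorial (real (m + n)) n"
    unfolding falling_factorial_def prod.lessThan_Suc_shift by simp
  also have "\<dots> = fact (m + Suc n) / fact m"
    using Suc.IH by (simp del: of_nat_Suc of_nat_add)
  finally show ?case .
qed

lemma falling_factorial_nonneg: "0 \<le> falling_factorial (real k) n"
proof (cases "k < n")
  case True
  then show ?thesis by (simp add: falling_factorial_eq_0)
next
  case False
  then show ?thesis using falling_factorial_add[of "k - n" n] by simp
qed

lemma pochhammer_of_nat_eq_binomial: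
  "pochhammer (real j) n = fact n * real ((j + n - 1) choose n)"
proof (cases n)
  case 0
  then show ?thesis by simp
next
  case (Suc m)
  have "real ((j + m) choose n) = pochhammer (real (j + m) - real n + 1) n / fact n"
    by (simp only: binomial_gbinomial gbinomial_pochhammer')
  also have "real (j + m) - real n + 1 = real j"
    using Suc by simp
  finally show ?thesis
    using Suc by (simp del: fact_Suc)
qed

section \<open>Rising factorial moments of the Poisson law\<close>

text \<open>The coefficients are the unsigned Lah numbers, which convert rising factorials into falling
  ones.  The natural number \<open>n - 1\<close> is truncated at \<open>n = 0\<close>, where the sum has the correct value 1.\<close>
definition lah_poly :: "nat \<Rightarrow> real \<Rightarrow> real" where
  "lah_poly n x = (\<Sum>s\<le>n. real ((n - 1) choose (n - s)) * fact n / fact s * x ^ s)"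

lemma lah_poly_0 [simp]: "lah_poly 0 x = 1"
  by (simp add: lah_poly_def)

text \<open>The shifted index removes the term \<open>s = 0\<close>, whose coefficient vanishes for positive \<open>n\<close>.\<close>
lemma lah_poly_shift:
  assumes "1 \<le> n"
  shows "lah_poly n x =
    fact n * (\<Sum>s = 0..n - 1. 1 / fact (s + 1) * real ((n - 1) choose s) * x ^ (s + 1))"
proof -
  obtain m where n: "n = Suc m" using assms by (cases n) auto
  have sym: "real (m choose (m - s)) = real (m choose s)" if "s \<le> m" for s
    using that by (simp add: binomial_symmetric[symmetric])
  have "lah_poly n x = (\<Sum>s\<le>m. real (m choose (m - s)) * fact n / fact (Suc s) * x ^ Suc s)"
    unfolding lah_poly_def n sum.atMost_Suc_shift by simp
  also have "\<dots> = (\<Sum>s\<le>m. fact n * (1 / fact (s + 1) * real (m choose s) * x ^ (s + 1)))"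
    by (rule sum.cong) (simp_all add: sym)
  finally show ?thesis
    by (simp add: n sum_distrib_left atLeast0AtMost)
qed

lemma exp_real_sums: "(\<lambda>j. x ^ j / fact j) sums exp (x :: real)"
  using exp_converges[of x] by (simp add: divide_inverse mult.commute)

text \<open>The first \<open>s\<close> terms vanish, and the remaining ones are a shifted exponential series.\<close>
lemma poisson_binomial_moment:
  "(\<lambda>j. x ^ j / fact j * real (j choose s)) sums (x ^ s / fact s * exp (x :: real))"
proof -
  have "(\<lambda>j. x ^ s / fact s * (x ^ j / fact j)) sums (x ^ s / fact s * exp x)"
    by (rule sums_mult) (rule exp_real_sums)
  also have "(\<lambda>j. x ^ s / fact s * (x ^ j / fact j)) =
      (\<lambda>j. x ^ (j + s) / fact (j + s) * real ((j + s) choose s))"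
  proof
    fix j
    have "real ((j + s) choose s) = fact (j + s) / (fact s * fact j)"
      by (simp add: binomial_fact)
    then show "x ^ s / fact s * (x ^ j / fact j) =
        x ^ (j + s) / fact (j + s) * real ((j + s) choose s)"
      by (simp add: power_add)
  qed
  finally show ?thesis
    by (subst (asm) sums_iff_shift) (simp add: binomial_eq_0)
qed

text \<open>Vandermonde's identity splits the rising factorial \<open>n! \<cdot> binom (j + n - 1) n\<close> into binomial
  coefficients of \<open>j\<close>, whose Poisson means are the monomials \<open>x\<^sup>s / s!\<close>.\<close>
lemma poisson_rising_factorial:
  fixes x :: real
  assumes "0 \<le> x"
  shows "((\<lambda>j. x ^ j / fact j * pochhammer (real j) n) has_sum lah_poly n x * exp x) UNIV"
proof (rule sums_nonneg_imp_has_sum)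
  have vd: "pochhammer (real j) n =
      (\<Sum>s\<le>n. fact n * real ((n - 1) choose (n - s)) * real (j choose s))" for j
  proof (cases n)
    case 0
    then show ?thesis by simp
  next
    case (Suc m)
    have "pochhammer (real j) n = fact n * real ((j + m) choose n)"
      using pochhammer_of_nat_eq_binomial[of j n] Suc by simp
    also have "(j + m) choose n = (\<Sum>s\<le>n. (j choose s) * (m choose (n - s)))"
      by (rule vandermonde[symmetric])
    finally show ?thesis
      using Suc by (simp add: sum_distrib_left mult_ac del: fact_Suc sum.atMost_Suc)
  qed
  have "(\<lambda>j. \<Sum>s\<le>n. fact n * real ((n - 1) choose (n - s)) * (x ^ j / fact j * real (j choose s)))
      sums (\<Sum>s\<le>n. fact n * real ((n - 1) choose (n - s)) * (x ^ s / fact s * exp x))"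
    by (intro sums_sum sums_mult poisson_binomial_moment)
  then show "(\<lambda>j. x ^ j / fact j * pochhammer (real j) n) sums (lah_poly n x * exp x)"
    by (simp add: vd lah_poly_def sum_distrib_left sum_distrib_right mult_ac)
  show "0 \<le> x ^ j / fact j * pochhammer (real j) n" for j
    using assms by (simp add: pochhammer_of_nat_eq_binomial)
qed

section \<open>Factorial sums of the negative binomial law\<close>

lemma negative_binomial_series:
  fixes y :: real
  assumes "\<bar>y\<bar> < 1"
  shows "(\<lambda>m. pochhammer (real r) m / fact m * y ^ m) sums (1 / (1 - y) ^ r)"
proof -
  have "(\<lambda>m. (- real r gchoose m) * (- y) ^ m) sums (1 + - y) powr (- real r)"
    by (rule gen_binomial_real) (use assms in simp)
  moreover have "(- real r gchoose m) * (- y) ^ m = pochhammer (real r) m / fact m * y ^ m" for m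
  proof -
    have "(- 1) ^ m * (- y) ^ m = y ^ m"
      by (simp flip: power_mult_distrib)
    then show ?thesis
      by (simp add: gbinomial_pochhammer mult_ac)
  qed
  moreover have "(1 + - y) powr (- real r) = 1 / (1 - y) ^ r"
    using assms by (simp add: powr_minus powr_realpow divide_inverse)
  ultimately show ?thesis by simp
qed

text \<open>The falling factorial cancels \<open>n\<close> factors of \<open>k!\<close> and kills the terms \<open>k < n\<close>; what remains
  after the shift \<open>k = m + n\<close> is the negative binomial series with exponent \<open>j + n\<close>.\<close>
lemma negative_binomial_factorial_sum:
  fixes y :: real
  assumes "\<bar>y\<bar> < 1"
  shows "(\<lambda>k. pochhammer (real j) k / fact k * falling_factorial (real k) n * y ^ k) sums
    (pochhammer (real j) n * y ^ n / (1 - y) ^ (j + n))"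
proof -
  let ?f = "\<lambda>k. pochhammer (real j) k / fact k * falling_factorial (real k) n * y ^ k"
  have "(\<lambda>m. pochhammer (real j) n * y ^ n * (pochhammer (real (j + n)) m / fact m * y ^ m)) sums
      (pochhammer (real j) n * y ^ n * (1 / (1 - y) ^ (j + n)))"
    by (rule sums_mult) (rule negative_binomial_series[OF assms])
  also have "(\<lambda>m. pochhammer (real j) n * y ^ n * (pochhammer (real (j + n)) m / fact m * y ^ m))
      = (\<lambda>m. ?f (m + n))"
  proof
    fix m
    have "pochhammer (real j) (m + n) = pochhammer (real j) n * pochhammer (real (j + n)) m"
      using pochhammer_product'[of "real j" n m] by (simp add: add.commute)
    then show "pochhammer (real j) n * y ^ n * (pochhammer (real (j + n)) m / fact m * y ^ m)
        = ?f (m + n)"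
      by (simp add: falling_factorial_add power_add del: of_nat_add)
  qed
  finally show ?thesis
    using sums_iff_shift[of ?f n] by (simp add: falling_factorial_eq_0)
qed

section \<open>The generating function of the Lah polynomials\<close>

text \<open>Both sides equal \<open>exp (- \<mu>)\<close> times the double sum over \<open>j\<close> and \<open>k\<close> of
  \<open>\<mu>\<^sup>j / j! \<cdot> pochhammer j k / k! \<cdot> (k)\<^sub>n y\<^sup>k\<close>.  Summing over \<open>j\<close> first is a Poisson sum with
  parameter \<open>\<mu>\<close>.  Summing over \<open>k\<close> first replaces \<open>\<mu>\<close> by \<open>\<mu> / (1 - y)\<close> and leaves a Poisson sum with
  that parameter, whence the exponent \<open>\<mu> / (1 - y) - \<mu>\<close>.\<close>
lemma lah_factorial_generating_function:
  fixes \<mu> y :: real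
  assumes "0 \<le> \<mu>" and "\<bar>y\<bar> < 1"
  shows "((\<lambda>k. lah_poly k \<mu> / fact k * falling_factorial (real k) n * y ^ k) has_sum
    (y / (1 - y)) ^ n * lah_poly n (\<mu> / (1 - y)) * exp (\<mu> * y / (1 - y))) UNIV"
proof -
  define F where "F y = (\<lambda>(j, k). \<mu> ^ j / fact j *
      (pochhammer (real j) k / fact k * falling_factorial (real k) n * y ^ k))" for y :: real
  define G where "G y j = \<mu> ^ j / fact j * (pochhammer (real j) n * y ^ n / (1 - y) ^ (j + n))"
    for y :: real and j
  have F_nonneg: "0 \<le> F t (j, k)" if "0 \<le> t" for t j k
    using that assms(1)
    by (auto simp: F_def pochhammer_of_nat_eq_binomial
        intro!: mult_nonneg_nonneg divide_nonneg_nonneg falling_factorial_nonneg)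
  have row_sums: "(\<lambda>k. F t (j, k)) sums G t j" if "\<bar>t\<bar> < 1" for t j
    using sums_mult[OF negative_binomial_factorial_sum[OF that], of "\<mu> ^ j / fact j"]
    by (simp add: F_def G_def)
  have G_sum: "(G t has_sum (t / (1 - t)) ^ n *
      (lah_poly n (\<mu> / (1 - t)) * exp (\<mu> / (1 - t)))) UNIV" if "\<bar>t\<bar> < 1" for t
  proof -
    have "G t = (\<lambda>j. (t / (1 - t)) ^ n *
        ((\<mu> / (1 - t)) ^ j / fact j * pochhammer (real j) n))"
      by (rule ext) (simp add: G_def power_divide power_add field_simps)
    moreover have "0 \<le> \<mu> / (1 - t)" using that assms(1) by simp
    ultimately show ?thesis
      by (simp only: has_sum_cmult_right poisson_rising_factorial)
  qed
  \<comment> \<open>Absolute summability for \<open>y\<close> is summability for \<open>\<bar>y\<bar>\<close>, where all terms are nonnegative.\<close>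
  have "F \<bar>y\<bar> summable_on UNIV \<times> UNIV"
  proof (rule summable_on_SigmaI)
    show "((\<lambda>k. F \<bar>y\<bar> (j, k)) has_sum G \<bar>y\<bar> j) UNIV" for j
      by (rule sums_nonneg_imp_has_sum) (use assms(2) in \<open>auto intro!: row_sums F_nonneg\<close>)
    show "G \<bar>y\<bar> summable_on UNIV"
      using G_sum[of "\<bar>y\<bar>"] assms(2) by (auto simp: summable_on_def)
  qed (simp add: F_nonneg)
  moreover have norm_F: "F \<bar>y\<bar> = (\<lambda>p. norm (F y p))"
  proof
    fix p :: "nat \<times> nat"
    obtain j k where p: "p = (j, k)" by force
    have "0 \<le> pochhammer (real j) k" by (simp add: pochhammer_of_nat_eq_binomial)
    then show "F \<bar>y\<bar> p = norm (F y p)"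
      using assms(1) falling_factorial_nonneg[of k n]
      by (simp add: F_def p abs_mult power_abs)
  qed
  ultimately have summable: "F y summable_on UNIV \<times> UNIV"
    by (simp only: abs_summable_summable)
  have row: "((\<lambda>k. F y (j, k)) has_sum G y j) UNIV" for j
  proof (rule norm_summable_imp_has_sum)
    have "summable (\<lambda>k. F \<bar>y\<bar> (j, k))"
      by (rule sums_summable[OF row_sums]) (use assms(2) in simp)
    then show "summable (\<lambda>k. norm (F y (j, k)))"
      by (simp only: norm_F)
  qed (rule row_sums[OF assms(2)])
  define S where "S = (y / (1 - y)) ^ n * (lah_poly n (\<mu> / (1 - y)) * exp (\<mu> / (1 - y)))"
  have "(F y has_sum S) (UNIV \<times> UNIV)"
    unfolding S_def by (rule has_sum_SigmaI[OF row G_sum[OF assms(2)] summable])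
  then have swapped: "((\<lambda>(k, j). F y (j, k)) has_sum S) (UNIV \<times> UNIV)"
    by (rule has_sum_swap[THEN iffD1])
  have column: "((\<lambda>j. F y (j, k)) has_sum
      (lah_poly k \<mu> * exp \<mu>) * (falling_factorial (real k) n * y ^ k / fact k)) UNIV" for k
  proof -
    have "(\<lambda>j. F y (j, k)) = (\<lambda>j. \<mu> ^ j / fact j * pochhammer (real j) k *
        (falling_factorial (real k) n * y ^ k / fact k))"
      by (simp add: F_def mult_ac)
    then show ?thesis
      by (simp only: has_sum_cmult_left poisson_rising_factorial[OF assms(1)])
  qed
  have "((\<lambda>k. (lah_poly k \<mu> * exp \<mu>) * (falling_factorial (real k) n * y ^ k / fact k)) has_sum S)
      UNIV"
    by (rule has_sum_SigmaD[OF swapped]) (use column in simp)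
  then have "((\<lambda>k. exp (- \<mu>) * ((lah_poly k \<mu> * exp \<mu>) *
      (falling_factorial (real k) n * y ^ k / fact k))) has_sum (exp (- \<mu>) * S)) UNIV"
    by (rule has_sum_cmult_right)
  moreover have "exp (- \<mu>) * ((lah_poly k \<mu> * exp \<mu>) * (falling_factorial (real k) n * y ^ k / fact k))
      = lah_poly k \<mu> / fact k * falling_factorial (real k) n * y ^ k" for k
    by (simp add: exp_minus field_simps)
  moreover have "exp (- \<mu>) * S =
      (y / (1 - y)) ^ n * lah_poly n (\<mu> / (1 - y)) * exp (\<mu> * y / (1 - y))"
  proof -
    have "\<mu> / (1 - y) + - \<mu> = \<mu> * y / (1 - y)"
      using assms(2) by (simp add: field_simps)
    then have "exp (\<mu> / (1 - y)) * exp (- \<mu>) = exp (\<mu> * y / (1 - y))"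
      by (simp only: exp_add[symmetric])
    then show ?thesis
      unfolding S_def by (metis mult.assoc mult.commute)
  qed
  ultimately show ?thesis by (simp only:)
qed

section \<open>Laws on the natural numbers and their generating functions\<close>

text \<open>If the coefficients below \<open>k\<close> agree, dividing the difference by \<open>x\<^sup>k\<close> leaves a series that
  vanishes off 0, and its constant term is the limit at 0.\<close>
lemma powser_coeffs_unique:
  fixes a b :: "nat \<Rightarrow> real"
  assumes "\<And>x. \<bar>x\<bar> < 1 \<Longrightarrow> (\<lambda>k. a k * x ^ k) sums f x"
    and "\<And>x. \<bar>x\<bar> < 1 \<Longrightarrow> (\<lambda>k. b k * x ^ k) sums f x"
  shows "a k = b k"
proof (induction k rule: less_induct)
  case (less k)
  define d where "d i = a i - b i" for i
  have "(\<lambda>i. d (i + k) * x ^ i) sums 0" if x: "x \<noteq> 0" "norm x < 1" for x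
  proof -
    have "(\<lambda>i. d i * x ^ i) sums 0"
      using sums_diff[OF assms(1) assms(2), of x x] x by (simp add: d_def left_diff_distrib)
    then have "(\<lambda>i. d (i + k) * x ^ (i + k)) sums 0"
      using less by (subst sums_iff_shift) (simp add: d_def)
    then have "(\<lambda>i. d (i + k) * x ^ (i + k) / x ^ k) sums (0 / x ^ k)"
      by (rule sums_divide)
    then show ?thesis
      using x by (simp add: power_add)
  qed
  then have "((\<lambda>_. 0) \<longlongrightarrow> d (0 + k)) (at (0::real))"
    by (intro powser_limit_0_strong[of 1 "\<lambda>i. d (i + k)"]) auto
  then have "d k = 0"
    by (simp add: tendsto_const_iff)
  then show ?case by (simp add: d_def)
qed

lemma nat_law_eq_density:
  fixes D :: "nat measure"
  assumes "prob_space D" and "sets D = UNIV"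
  shows "D = density (count_space UNIV) (\<lambda>k. ennreal (measure D {k}))"
proof (rule measure_eqI_countable[where A = UNIV])
  interpret prob_space D by fact
  show "emeasure D {k} =
      emeasure (density (count_space UNIV) (\<lambda>k. ennreal (measure D {k}))) {k}" for k
    by (simp add: emeasure_density emeasure_eq_measure nn_integral_indicator_singleton)
qed (use assms in auto)

lemma nat_law_integrable_iff:
  fixes D :: "nat measure" and f :: "nat \<Rightarrow> real"
  assumes "prob_space D" and "sets D = UNIV"
  shows "integrable D f \<longleftrightarrow> summable (\<lambda>k. \<bar>measure D {k} * f k\<bar>)"
proof -
  have "integrable D f \<longleftrightarrow>
      integrable (density (count_space UNIV) (\<lambda>k. ennreal (measure D {k}))) f"
    using nat_law_eq_density[OF assms] by simp
  also have "\<dots> \<longleftrightarrow> integrable (count_space UNIV) (\<lambda>k. measure D {k} * f k)"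
    by (subst integrable_density) auto
  finally show ?thesis
    by (simp add: integrable_count_space_nat_iff)
qed

lemma nat_law_integral_sums:
  fixes D :: "nat measure" and f :: "nat \<Rightarrow> real"
  assumes "prob_space D" and "sets D = UNIV" and "integrable D f"
  shows "(\<lambda>k. measure D {k} * f k) sums (\<integral>k. f k \<partial>D)"
proof -
  have "integrable (count_space UNIV) (\<lambda>k. measure D {k} * f k)"
    using nat_law_integrable_iff[OF assms(1,2), of f] assms(3)
    by (simp add: integrable_count_space_nat_iff)
  moreover have "(\<integral>k. f k \<partial>D) =
      (\<integral>k. f k \<partial>density (count_space UNIV) (\<lambda>k. ennreal (measure D {k})))"
    using nat_law_eq_density[OF assms(1,2)] by simp
  moreover have "\<dots> = (\<integral>k. measure D {k} * f k \<partial>count_space UNIV)"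
    by (subst integral_density) auto
  ultimately show ?thesis
    by (simp only: sums_integral_count_space_nat)
qed

lemma pgf_sums:
  assumes "prob_space D" and "sets D = UNIV" and "\<bar>z\<bar> \<le> 1"
  shows "(\<lambda>k. measure D {k} * z ^ k) sums pgf D z"
  unfolding pgf_def
proof (rule nat_law_integral_sums[OF assms(1,2)])
  interpret prob_space D by fact
  have "(\<lambda>k. z ^ k) \<in> borel_measurable D"
    using sets_eq_imp_space_eq[of D "count_space UNIV"] assms(2)
    by (simp add: measurable_def)
  then show "integrable D (\<lambda>k. z ^ k)"
    using assms(3) by (intro integrable_const_bound[where B = 1]) (auto simp: power_abs power_le_one)
qed

section \<open>Factorial moments of the law\<close>

text \<open>With \<open>\<mu> = l (1 - \<kappa>) / \<kappa>\<close> the exponent of the generating function is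
  \<open>- l + \<mu> y / (1 - y)\<close> at \<open>y = \<kappa> z\<close>, so its power series is read off from the Lah polynomials.\<close>
lemma PDS_point_mass:
  assumes "is_PDS 1 l \<kappa> D" and "0 < \<kappa>"
  shows "measure D {k} = exp (- l) * (lah_poly k (l * (1 - \<kappa>) / \<kappa>) / fact k) * \<kappa> ^ k"
proof (rule powser_coeffs_unique)
  define \<mu> where "\<mu> = l * (1 - \<kappa>) / \<kappa>"
  have l: "0 < l" and \<kappa>: "\<kappa> < 1" and D: "prob_space D" "sets D = UNIV"
    and pgf: "\<And>z. \<bar>z\<bar> \<le> 1 \<Longrightarrow> pgf D z = exp (- l * ((1 - z) / (1 - \<kappa> * z)) powr 1)"
    using assms(1) by (auto simp: is_PDS_def)
  fix z :: real
  assume z: "\<bar>z\<bar> < 1"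
  show "(\<lambda>k. measure D {k} * z ^ k) sums pgf D z"
    using z by (intro pgf_sums D) simp
  have "\<bar>\<kappa> * z\<bar> < 1 * 1"
    unfolding abs_mult using z \<kappa> assms(2) by (intro mult_strict_mono) auto
  then have y: "\<bar>\<kappa> * z\<bar> < 1" by simp
  then have "\<bar>(1 - z) / (1 - \<kappa> * z)\<bar> = (1 - z) / (1 - \<kappa> * z)" using z by simp
  then have "pgf D z = exp (- l * ((1 - z) / (1 - \<kappa> * z)))"
    using pgf[OF less_imp_le[OF z]] by (simp only: powr_one')
  also have "- l * ((1 - z) / (1 - \<kappa> * z)) = - l + \<mu> * (\<kappa> * z) / (1 - \<kappa> * z)"
    using y assms(2) by (simp add: \<mu>_def field_simps)
  finally have pgf_z: "pgf D z = exp (- l) * exp (\<mu> * (\<kappa> * z) / (1 - \<kappa> * z))"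
    by (simp only: exp_add)
  have "0 \<le> \<mu>" using l \<kappa> assms(2) by (simp add: \<mu>_def)
  from has_sum_imp_sums[OF lah_factorial_generating_function[OF this y, of 0]]
  have "(\<lambda>k. lah_poly k \<mu> / fact k * (\<kappa> * z) ^ k) sums exp (\<mu> * (\<kappa> * z) / (1 - \<kappa> * z))"
    by (simp add: falling_factorial_def)
  from sums_mult[OF this, of "exp (- l)"]
  show "(\<lambda>k. exp (- l) * (lah_poly k (l * (1 - \<kappa>) / \<kappa>) / fact k) * \<kappa> ^ k * z ^ k) sums pgf D z"
    by (simp add: pgf_z power_mult_distrib mult_ac flip: \<mu>_def)
qed

text \<open>This is the factorial generating function at \<open>y = \<kappa>\<close>, where \<open>\<mu> y / (1 - y) = l\<close>, so that
  the two exponentials cancel.\<close>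
lemma PDS_factorial_moment:
  assumes "is_PDS 1 l \<kappa> D" and "0 < \<kappa>"
  shows "integrable D (\<lambda>k. falling_factorial (real k) n)"
    and "(\<integral>k. falling_factorial (real k) n \<partial>D) = (\<kappa> / (1 - \<kappa>)) ^ n * lah_poly n (l / \<kappa>)"
proof -
  define \<mu> where "\<mu> = l * (1 - \<kappa>) / \<kappa>"
  have l: "0 < l" and \<kappa>: "\<kappa> < 1" and D: "prob_space D" "sets D = UNIV"
    using assms(1) by (auto simp: is_PDS_def)
  have "0 \<le> \<mu>" and "\<bar>\<kappa>\<bar> < 1"
    using l \<kappa> assms(2) by (simp_all add: \<mu>_def)
  from sums_mult[OF has_sum_imp_sums[OF lah_factorial_generating_function[OF this, of n]],
      of "exp (- l)"]
  have "(\<lambda>k. measure D {k} * falling_factorial (real k) n) sums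
      (exp (- l) * ((\<kappa> / (1 - \<kappa>)) ^ n * lah_poly n (\<mu> / (1 - \<kappa>)) * exp (\<mu> * \<kappa> / (1 - \<kappa>))))"
    by (simp add: PDS_point_mass[OF assms] mult_ac flip: \<mu>_def)
  moreover have "\<mu> / (1 - \<kappa>) = l / \<kappa>" and "\<mu> * \<kappa> / (1 - \<kappa>) = l"
    using \<kappa> assms(2) by (simp_all add: \<mu>_def)
  ultimately have sums: "(\<lambda>k. measure D {k} * falling_factorial (real k) n) sums
      ((\<kappa> / (1 - \<kappa>)) ^ n * lah_poly n (l / \<kappa>))"
    by (simp add: exp_minus field_simps)
  show int: "integrable D (\<lambda>k. falling_factorial (real k) n)"
    using sums_summable[OF sums]
    by (simp add: nat_law_integrable_iff[OF D] abs_mult falling_factorial_nonneg)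
  show "(\<integral>k. falling_factorial (real k) n \<partial>D) = (\<kappa> / (1 - \<kappa>)) ^ n * lah_poly n (l / \<kappa>)"
    using sums_unique2[OF nat_law_integral_sums[OF D int] sums] .
qed

theorem theorem3p5:
  fixes l \<kappa> :: real and n :: nat and M :: "'a measure" and X :: "'a \<Rightarrow> nat"
  assumes "0 < l" and "0 < \<kappa>" and "\<kappa> < 1"
    and "prob_space M" and "X \<in> measurable M (count_space UNIV)"
    and "is_PDS 1 l \<kappa> (distr M (count_space UNIV) X)"
    and "1 \<le> n"
  shows "integrable M (\<lambda>\<omega>. falling_factorial (real (X \<omega>)) n) \<and>
    prob_space.expectation M (\<lambda>\<omega>. falling_factorial (real (X \<omega>)) n) =
      \<kappa> ^ n / (1 - \<kappa>) ^ n * fact n *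
        (\<Sum>s = 0..n - 1. 1 / fact (s + 1) * real ((n - 1) choose s) * (l ^ (s + 1) / \<kappa> ^ (s + 1)))"
proof
  note moment = PDS_factorial_moment[OF assms(6,2), of n]
  show "integrable M (\<lambda>\<omega>. falling_factorial (real (X \<omega>)) n)"
    using integrable_distr[OF assms(5) moment(1)] .
  have "prob_space.expectation M (\<lambda>\<omega>. falling_factorial (real (X \<omega>)) n) =
      (\<integral>k. falling_factorial (real k) n \<partial>distr M (count_space UNIV) X)"
    by (rule integral_distr[OF assms(5), symmetric]) simp
  also have "\<dots> = (\<kappa> / (1 - \<kappa>)) ^ n * lah_poly n (l / \<kappa>)"
    by (rule moment(2))
  finally show "prob_space.expectation M (\<lambda>\<omega>. falling_factorial (real (X \<omega>)) n) =
      \<kappa> ^ n / (1 - \<kappa>) ^ n * fact n *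
        (\<Sum>s = 0..n - 1. 1 / fact (s + 1) * real ((n - 1) choose s) * (l ^ (s + 1) / \<kappa> ^ (s + 1)))"
    by (simp only: lah_poly_shift[OF assms(7)] power_divide mult.assoc)
qed

end
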